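(* Let $\sum_{n=0}^\infty u_n$ be a series of fuzzy numbers and let $\nu$ be a fuzzy number. If the series $\sum u_n$ is Cesàro summable to $\nu$ and $nD(u_n,\bar 0)=o(1)$ as $n\to\infty$, then $\sum_{n=0}^\infty u_n=\nu$, i.e. the series converges to $\nu$.
   Context: A fuzzy number is a function $u:\mathbb{R}\to[0,1]$ that is normal ($u(t_0)=1$ for some $t_0$), fuzzy convex ($u(\lambda s+(1-\lambda)t)\ge\min\{u(s),u(t)\}$ for $s,t\in\mathbb{R}$, $\lambda\in[0,1]$), upper semicontinuous, and has compact support $\overline{\{t:u(t)>0\}}$. The set of fuzzy numbers is $E^1$. For $u\in E^1$ the $\alpha$-level set is $[u]_\alpha=\{t:u(t)\ge\alpha\}$ for $0<\alpha\le1$ and $[u]_0=\overline{\{t:u(t)>0\}}$; it is a compact interval, written $[u]_\alpha=[u^-_\alpha,u^+_\alpha]$. Addition and scalar multiplication ($k\in\mathbb{R}$) are defined by $[u+v]_\alpha=[u^-_\alpha+v^-_\alpha,\,u^+_\alpha+v^+_\alpha]$ and $[ku]_\alpha=k[u]_\alpha$ for all $\alpha\in[0,1]$. The metric on $E^1$ is $D(u,v)=\sup_{\alpha\in[0,1]}\max\{|u^-_\alpha-v^-_\alpha|,|u^+_\alpha-v^+_\alpha|\}$; convergence in $E^1$ is with respect to $D$. The fuzzy number $\bar 0$ is given by $\bar 0(0)=1$ and $\bar 0(t)=0$ for $t\neq0$. A series $\sum_{n=0}^\infty u_n$ of fuzzy numbers converges to $u\in E^1$, written $\sum_{n=0}^\infty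 u_n=u$, if its partial sums $s_n=\sum_{k=0}^n u_k$ converge to $u$. The series $\sum u_n$ is Cesàro summable to $\nu\in E^1$ if its sequence of partial sums $(s_n)$ is Cesàro summable to $\nu$, i.e. $\frac{1}{n+1}\sum_{k=0}^n s_k$ converges to $\nu$. *)

theory Defs
  imports "HOL-Analysis.Analysis" "HOL-Library.Landau_Symbols"
begin

section \<open>Fuzzy numbers\<close>

definition upper_semicontinuous :: "(real \<Rightarrow> real) \<Rightarrow> bool" where
  "upper_semicontinuous f \<longleftrightarrow> (\<forall>t. \<forall>c>f t. \<forall>\<^sub>F s in nhds t. f s < c)"

definition is_fuzzy_number :: "(real \<Rightarrow> real) \<Rightarrow> bool" where
  "is_fuzzy_number u \<longleftrightarrow>
     range u \<subseteq> {0..1} \<and>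
     (\<exists>t0. u t0 = 1) \<and>
     (\<forall>s t. \<forall>l\<in>{0..1}. u (l * s + (1 - l) * t) \<ge> min (u s) (u t)) \<and>
     upper_semicontinuous u \<and>
     compact (closure {t. u t > 0})"

lemma upper_semicontinuous_iff_closed:
  "upper_semicontinuous u \<longleftrightarrow> (\<forall>a. closed {t. a \<le> u t})"
proof
  assume u: "upper_semicontinuous u"
  show "\<forall>a. closed {t. a \<le> u t}"
  proof
    fix a
    have "open {t. u t < a}"
      unfolding open_subopen[of "{t. u t < a}"]
    proof (intro ballI)
      fix t assume "t \<in> {t. u t < a}"
      then have "\<forall>\<^sub>F s in nhds t. u s < a"
        using u unfolding upper_semicontinuous_def by auto
      then show "\<exists>T. open T \<and> t \<in> T \<and> T \<subseteq> {t. u t < a}"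
        unfolding eventually_nhds by auto
    qed
    moreover have "- {t. a \<le> u t} = {t. u t < a}" by auto
    ultimately show "closed {t. a \<le> u t}" by (simp add: closed_def)
  qed
next
  assume cl: "\<forall>a. closed {t. a \<le> u t}"
  show "upper_semicontinuous u"
    unfolding upper_semicontinuous_def
  proof (intro allI impI)
    fix t c assume "u t < c"
    have "- {t. c \<le> u t} = {t. u t < c}" by auto
    with cl have "open {t. u t < c}" by (metis closed_def)
    with \<open>u t < c\<close> show "\<forall>\<^sub>F s in nhds t. u s < c"
      unfolding eventually_nhds by blast
  qed
qed

lemma is_fuzzy_number_indicator_0: "is_fuzzy_number (indicator {0})"
proof -
  have eq: "{t. (0::real) < indicator {0::real} t} = {0}"
    by (auto simp: indicator_def)
  have cl: "closed {t. a \<le> indicator {0::real} t}" for a :: real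
  proof -
    consider "{t. a \<le> indicator {0::real} t} = {}" | "{t. a \<le> indicator {0::real} t} = {0}"
      | "{t. a \<le> indicator {0::real} t} = UNIV"
      by (cases "a \<le> 0"; cases "a \<le> 1") (force simp: indicator_def)+
    then show ?thesis by cases simp_all
  qed
  show ?thesis
    unfolding is_fuzzy_number_def upper_semicontinuous_iff_closed eq
    using cl by (auto simp: indicator_def)
qed

typedef fuzzy_number = "{u. is_fuzzy_number u}"
  morphisms membership Abs_fuzzy_number
  using is_fuzzy_number_indicator_0 by blast

definition level :: "fuzzy_number \<Rightarrow> real \<Rightarrow> real set" where
  "level u a = (if a = 0 then closure {t. membership u t > 0} else {t. membership u t \<ge> a})"

definition lower :: "fuzzy_number \<Rightarrow> real \<Rightarrow> real" where
  "lower u a = Inf (level u a)"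

definition upper :: "fuzzy_number \<Rightarrow> real \<Rightarrow> real" where
  "upper u a = Sup (level u a)"

lemma is_fuzzy_number_membership: "is_fuzzy_number (membership u)"
  using membership[of u] by simp

lemma membership_bounds: "0 \<le> membership u t" "membership u t \<le> 1"
  using is_fuzzy_number_membership[of u] unfolding is_fuzzy_number_def
  by (meson atLeastAtMost_iff rangeI subsetD)+

lemma level_nonempty: "a \<in> {0..1} \<Longrightarrow> level u a \<noteq> {}"
proof -
  assume a: "a \<in> {0..1}"
  obtain t where t: "membership u t = 1"
    using is_fuzzy_number_membership[of u] unfolding is_fuzzy_number_def by auto
  then have "t \<in> level u a"
    using a closure_subset[of "{t. membership u t > 0}"] by (auto simp: level_def)
  then show ?thesis by auto
qed

lemma level_subset_0: "0 < a \<Longrightarrow> level u a \<subseteq> level u 0"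
  using closure_subset[of "{t. membership u t > 0}"] by (auto simp: level_def)

lemma level_antimono: "0 \<le> a \<Longrightarrow> a \<le> b \<Longrightarrow> level u b \<subseteq> level u a"
  using level_subset_0[of b u] by (cases "a = 0"; cases "b = 0") (auto simp: level_def)

lemma compact_level: "0 \<le> a \<Longrightarrow> compact (level u a)"
proof -
  assume a: "0 \<le> a"
  have c0: "compact (level u 0)"
    using is_fuzzy_number_membership[of u] unfolding is_fuzzy_number_def level_def by auto
  show ?thesis
  proof (cases "a = 0")
    case False
    then have "closed (level u a)"
      using is_fuzzy_number_membership[of u]
      unfolding is_fuzzy_number_def level_def upper_semicontinuous_iff_closed by auto
    then show ?thesis
      using c0 level_antimono[of 0 a u] a
      by (meson bounded_subset compact_eq_bounded_closed order_refl)
  qed (use c0 in simp)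
qed

lemma convex_superlevel:
  assumes "\<forall>s t. \<forall>l\<in>{0..1::real}. w (l * s + (1 - l) * t) \<ge> min (w s) (w (t::real) :: real)"
  shows "convex {t. a \<le> w t}" "convex {t. a < w t}"
proof -
  have *: "w (p * x + q * y) \<ge> min (w x) (w y)" if "0 \<le> p" "0 \<le> q" "p + q = 1" for p q x y
  proof -
    have "p \<in> {0..1}" "q = 1 - p" using that by auto
    then show ?thesis using assms by blast
  qed
  show "convex {t. a \<le> w t}" "convex {t. a < w t}"
    unfolding convex_def
    by (auto intro: order_trans[OF _ *] less_le_trans[OF _ *])
qed

lemma convex_level: "0 \<le> a \<Longrightarrow> convex (level u a)"
  using convex_superlevel[of "membership u"] is_fuzzy_number_membership[of u]
  unfolding is_fuzzy_number_def level_def by (auto intro: convex_closure)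

lemma level_eq_interval:
  assumes a: "a \<in> {0..1}"
  shows "level u a = {lower u a..upper u a}" "lower u a \<le> upper u a"
proof -
  have c: "compact (level u a)" and v: "convex (level u a)" and n: "level u a \<noteq> {}"
    using a compact_level convex_level level_nonempty by auto
  then obtain p q where pq: "level u a = {p..q}"
    using connected_compact_interval_1[of "level u a"] convex_connected by blast
  then have "p \<le> q" using n by auto
  then show "level u a = {lower u a..upper u a}" "lower u a \<le> upper u a"
    unfolding lower_def upper_def pq by auto
qed

lemma level_eq_iff:
  assumes "a \<in> {0..1}" "p \<le> q"
  shows "level u a = {p..q} \<longleftrightarrow> lower u a = p \<and> upper u a = q"
  using level_eq_interval[OF assms(1), of u] assms(2) by (auto simp: lower_def upper_def)

lemma fuzzy_number_eqI_level:
  assumes "\<And>a. a \<in> {0..1} \<Longrightarrow> level u a = level v a"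
  shows "u = v"
proof -
  have le: "membership u t \<le> membership v t"
    if "\<And>a. a \<in> {0..1} \<Longrightarrow> level u a = level v a" for u v t
  proof (cases "membership u t = 0")
    case True then show ?thesis using membership_bounds by auto
  next
    case False
    then have "t \<in> level u (membership u t)" by (auto simp: level_def)
    then have "t \<in> level v (membership u t)" using that membership_bounds by auto
    then show ?thesis using False by (auto simp: level_def)
  qed
  have "membership u = membership v"
    using le[of u v] le[of v u] assms by (intro ext antisym) auto
  then show ?thesis by (simp add: membership_inject)
qed

lemma fuzzy_number_eqI:
  assumes "\<And>a. a \<in> {0..1} \<Longrightarrow> lower u a = lower v a"
    and "\<And>a. a \<in> {0..1} \<Longrightarrow> upper u a = upper v a"
  shows "u = v"
  using fuzzy_number_eqI_level[of u v] assms level_eq_interval(1) by metis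

lemma lower_mono: "0 \<le> a \<Longrightarrow> a \<le> b \<Longrightarrow> b \<le> 1 \<Longrightarrow> lower u a \<le> lower u b"
  using level_antimono[of a b u] level_eq_interval[of a u] level_eq_interval[of b u] by auto

lemma upper_antimono: "0 \<le> a \<Longrightarrow> a \<le> b \<Longrightarrow> b \<le> 1 \<Longrightarrow> upper u b \<le> upper u a"
  using level_antimono[of a b u] level_eq_interval[of a u] level_eq_interval[of b u] by auto

lemma mem_level_limit:
  assumes "0 < a" "a \<le> 1" "\<And>b. 0 < b \<Longrightarrow> b < a \<Longrightarrow> t \<in> level u b"
  shows "t \<in> level u a"
proof -
  have "a \<le> membership u t"
  proof (rule dense_le_bounded[OF assms(1)])
    fix b assume "0 < b" "b < a"
    then show "b \<le> membership u t" using assms(3)[of b] by (auto simp: level_def)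
  qed
  then show ?thesis using assms(1) by (simp add: level_def)
qed

lemma lower_left_limit:
  assumes "0 < a" "a \<le> 1" "x < lower u a"
  obtains b where "0 < b" "b < a" "x < lower u b"
proof (rule ccontr)
  note witness = that
  assume "\<not> thesis"
  then have le: "lower u b \<le> x" if "0 < b" "b < a" for b using witness that by force
  have "x \<in> level u b" if "0 < b" "b < a" for b
    using le[OF that] upper_antimono[of b a u] level_eq_interval[of b u] level_eq_interval(2)[of a u]
      that assms by auto
  then have "x \<in> level u a" using mem_level_limit assms by blast
  then show False using level_eq_interval[of a u] assms by auto
qed

lemma upper_left_limit:
  assumes "0 < a" "a \<le> 1" "upper u a < x"
  obtains b where "0 < b" "b < a" "upper u b < x"
proof (rule ccontr)
  note witness = that
  assume "\<not> thesis"
  then have le: "x \<le> upper u b" if "0 < b" "b < a" for b using witness that by force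
  have "x \<in> level u b" if "0 < b" "b < a" for b
    using le[OF that] lower_mono[of b a u] level_eq_interval[of b u] level_eq_interval(2)[of a u]
      that assms by auto
  then have "x \<in> level u a" using mem_level_limit assms by blast
  then show False using level_eq_interval[of a u] assms by auto
qed

lemma support_approx:
  assumes "t \<in> level u 0" "0 < e"
  obtains b s where "0 < b" "b \<le> 1" "s \<in> level u b" "\<bar>s - t\<bar> < e"
proof -
  obtain s where s: "membership u s > 0" "dist s t < e"
    using assms closure_approachable[of t "{t. membership u t > 0}"] by (auto simp: level_def)
  show thesis
    using that[of "membership u s" s] s membership_bounds by (auto simp: level_def dist_real_def)
qed

lemma lower_right_limit_0:
  assumes "lower u 0 < x"
  obtains b where "0 < b" "b \<le> 1" "lower u b < x"
proof -
  have "lower u 0 \<in> level u 0" using level_eq_interval[of 0 u] by auto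
  then obtain b s where b: "0 < b" "b \<le> 1" "s \<in> level u b" "\<bar>s - lower u 0\<bar> < x - lower u 0"
    using support_approx[of "lower u 0" u "x - lower u 0"] assms by auto
  then have "lower u b < x" using level_eq_interval[of b u] by auto
  then show thesis using that b by blast
qed

lemma upper_right_limit_0:
  assumes "x < upper u 0"
  obtains b where "0 < b" "b \<le> 1" "x < upper u b"
proof -
  have "upper u 0 \<in> level u 0" using level_eq_interval[of 0 u] by auto
  then obtain b s where b: "0 < b" "b \<le> 1" "s \<in> level u b" "\<bar>s - upper u 0\<bar> < upper u 0 - x"
    using support_approx[of "upper u 0" u "upper u 0 - x"] assms by auto
  then have "x < upper u b" using level_eq_interval[of b u] by auto
  then show thesis using that b by blast
qed

text \<open>Construction of a fuzzy number from prescribed level intervals \<open>{l a..r a}\<close>.\<close>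

lemma fuzzy_number_from_levels:
  fixes l r :: "real \<Rightarrow> real"
  assumes lr: "l 1 \<le> r 1"
    and lmono: "\<And>a b. 0 \<le> a \<Longrightarrow> a \<le> b \<Longrightarrow> b \<le> 1 \<Longrightarrow> l a \<le> l b"
    and rmono: "\<And>a b. 0 \<le> a \<Longrightarrow> a \<le> b \<Longrightarrow> b \<le> 1 \<Longrightarrow> r b \<le> r a"
    and lleft: "\<And>a x. 0 < a \<Longrightarrow> a \<le> 1 \<Longrightarrow> x < l a \<Longrightarrow> \<exists>b. 0 < b \<and> b < a \<and> x < l b"
    and rleft: "\<And>a x. 0 < a \<Longrightarrow> a \<le> 1 \<Longrightarrow> r a < x \<Longrightarrow> \<exists>b. 0 < b \<and> b < a \<and> r b < x"
    and lright: "\<And>x. l 0 < x \<Longrightarrow> \<exists>b. 0 < b \<and> b \<le> 1 \<and> l b < x"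
    and rright: "\<And>x. x < r 0 \<Longrightarrow> \<exists>b. 0 < b \<and> b \<le> 1 \<and> x < r b"
  shows "\<exists>w. \<forall>a\<in>{0..1}. level w a = {l a..r a}"
proof -
  define S where "S t = insert 0 {a. 0 < a \<and> a \<le> 1 \<and> l a \<le> t \<and> t \<le> r a}" for t
  define w where "w t = Sup (S t)" for t
  have bdd: "bdd_above (S t)" for t
    unfolding S_def by (rule bdd_aboveI[of _ 1]) auto
  have w0: "0 \<le> w t" for t
    unfolding w_def by (rule cSup_upper) (auto simp: bdd, auto simp: S_def)
  have w1: "w t \<le> 1" for t
    unfolding w_def by (rule cSup_least) (auto simp: S_def)
  have lev: "{t. a \<le> w t} = {l a..r a}" if a: "0 < a" "a \<le> 1" for a
  proof (intro set_eqI iffI)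
    fix t assume "t \<in> {l a..r a}"
    then have "a \<in> S t" using a by (auto simp: S_def)
    then show "t \<in> {t. a \<le> w t}" unfolding w_def using bdd by (auto intro: cSup_upper)
  next
    fix t assume "t \<in> {t. a \<le> w t}"
    then have aw: "a \<le> w t" by simp
    have below: "l b \<le> t \<and> t \<le> r b" if b: "0 < b" "b < a" for b
    proof -
      have "b < Sup (S t)" using aw b unfolding w_def by simp
      then obtain c where c: "c \<in> S t" "b < c"
        using less_cSup_iff[of "S t" b] bdd by (auto simp: S_def)
      then have "0 < c" "c \<le> 1" "l c \<le> t" "t \<le> r c" using b by (auto simp: S_def)
      then show ?thesis using lmono[of b c] rmono[of b c] b c by auto
    qed
    have "l a \<le> t"
    proof (rule ccontr)
      assume "\<not> l a \<le> t"
      then obtain b where "0 < b" "b < a" "t < l b" using lleft[of a t] a by auto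
      then show False using below[of b] by auto
    qed
    moreover have "t \<le> r a"
    proof (rule ccontr)
      assume "\<not> t \<le> r a"
      then obtain b where "0 < b" "b < a" "r b < t" using rleft[of a t] a by auto
      then show False using below[of b] by auto
    qed
    ultimately show "t \<in> {l a..r a}" by simp
  qed
  have lra: "l a \<le> r a" if "0 \<le> a" "a \<le> 1" for a
    using lr lmono[of a 1] rmono[of a 1] that by auto
  have supp: "closure {t. w t > 0} = {l 0..r 0}"
  proof
    have "{t. w t > 0} \<subseteq> {l 0..r 0}"
    proof
      fix t assume "t \<in> {t. w t > 0}"
      then have "t \<in> {l (w t)..r (w t)}" using lev[of "w t"] w1[of t] by auto
      then show "t \<in> {l 0..r 0}"
        using lmono[of 0 "w t"] rmono[of 0 "w t"] w0[of t] w1[of t] by auto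
    qed
    then show "closure {t. w t > 0} \<subseteq> {l 0..r 0}" by (simp add: closure_minimal)
  next
    have inner: "{l 0<..<r 0} \<subseteq> {t. w t > 0}"
    proof
      fix t assume t: "t \<in> {l 0<..<r 0}"
      then obtain b where b: "0 < b" "b \<le> 1" "l b < t" using lright by auto
      obtain c where c: "0 < c" "c \<le> 1" "t < r c" using rright t by auto
      define d where "d = min b c"
      have d: "0 < d" "d \<le> 1" "d \<le> b" "d \<le> c" using b c by (auto simp: d_def)
      then have "t \<in> {l d..r d}"
        using b c lmono[of d b] rmono[of d c] by auto
      then have "d \<le> w t" using lev[of d] d by blast
      then show "t \<in> {t. w t > 0}" using d by simp
    qed
    show "{l 0..r 0} \<subseteq> closure {t. w t > 0}"
    proof (cases "l 0 < r 0")
      case True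
      then show ?thesis
        using closure_mono[OF inner] closure_greaterThanLessThan[of "l 0" "r 0"] by simp
    next
      case False
      have "l 1 \<in> {t. 1 \<le> w t}" using lev[of 1] lr by auto
      then have "l 1 \<in> {t. w t > 0}" by auto
      then have "l 1 \<in> closure {t. w t > 0}" by (rule subsetD[OF closure_subset])
      moreover have "t = l 1" if "t \<in> {l 0..r 0}" for t
        using that False lr lmono[of 0 1] rmono[of 0 1] by auto
      ultimately show ?thesis by (metis subsetI)
    qed
  qed
  have lev_int: "\<exists>p q. {t. a \<le> w t} = {p..q} \<or> {t. a \<le> w t} = UNIV" for a
  proof -
    consider "a \<le> 0" | "0 < a" "a \<le> 1" | "1 < a" by linarith
    then show ?thesis
    proof cases
      case 1
      then have "{t. a \<le> w t} = UNIV" using w0 by (auto intro: order_trans)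
      then show ?thesis by blast
    next
      case 2 then show ?thesis using lev by blast
    next
      case 3
      then have "{t. a \<le> w t} = {1..0}" using w1 by (auto simp: not_le intro: le_less_trans)
      then show ?thesis by blast
    qed
  qed
  have "is_fuzzy_number w"
    unfolding is_fuzzy_number_def
  proof (intro conjI)
    show "range w \<subseteq> {0..1}" using w0 w1 by (simp add: image_subset_iff)
    have "l 1 \<in> {t. 1 \<le> w t}" using lr by (subst lev) simp_all
    then have "1 \<le> w (l 1)" by simp
    then show "\<exists>t0. w t0 = 1" using w1[of "l 1"] by (intro exI[of _ "l 1"]) simp
    have "closed {t. a \<le> w t}" for a using lev_int[of a] by auto
    then show "upper_semicontinuous w"
      unfolding upper_semicontinuous_iff_closed by blast
    show "compact (closure {t. w t > 0})" unfolding supp by simp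
    show "\<forall>s t. \<forall>l\<in>{0..1}. w (l * s + (1 - l) * t) \<ge> min (w s) (w t)"
    proof (intro allI ballI)
      fix s t k :: real assume k: "k \<in> {0..1}"
      have "convex {x. min (w s) (w t) \<le> w x}"
        using lev_int[of "min (w s) (w t)"] by auto
      then have "k *\<^sub>R s + (1 - k) *\<^sub>R t \<in> {x. min (w s) (w t) \<le> w x}"
        by (rule convexD) (use k in auto)
      then show "w (k * s + (1 - k) * t) \<ge> min (w s) (w t)" by simp
    qed
  qed
  then have "membership (Abs_fuzzy_number w) = w"
    by (simp add: Abs_fuzzy_number_inverse)
  then have "\<forall>a\<in>{0..1}. level (Abs_fuzzy_number w) a = {l a..r a}"
    using lev supp by (auto simp: level_def)
  then show ?thesis by blast
qed

section \<open>Addition and scalar multiplication\<close>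

text \<open>Both operations are specified by their level sets on \<open>[0, 1]\<close>; existence and uniqueness of the
  described fuzzy numbers are established in \<open>level_plus\<close> and \<open>level_scaleR\<close> below. Since there are no
  additive inverses in general, \<open>scaleR\<close> is provided without the laws of a vector space.\<close>

instantiation fuzzy_number :: "{zero, plus, scaleR}"
begin

definition zero_fuzzy_number :: fuzzy_number where
  "0 = Abs_fuzzy_number (\<lambda>t. if t = 0 then 1 else 0)"

definition plus_fuzzy_number :: "fuzzy_number \<Rightarrow> fuzzy_number \<Rightarrow> fuzzy_number" where
  "u + v = (THE w. \<forall>a\<in>{0..1}. level w a = {lower u a + lower v a..upper u a + upper v a})"

definition scaleR_fuzzy_number :: "real \<Rightarrow> fuzzy_number \<Rightarrow> fuzzy_number" where
  "k *\<^sub>R u = (THE w. \<forall>a\<in>{0..1}. level w a = (\<lambda>t. k * t) ` level u a)"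

instance ..

end

lemma membership_zero: "membership 0 t = (if t = 0 then 1 else 0)"
proof -
  have "(\<lambda>t::real. if t = 0 then 1 else 0 :: real) = indicator {0}"
    by (auto simp: indicator_def)
  then show ?thesis
    using is_fuzzy_number_indicator_0
    by (simp add: zero_fuzzy_number_def Abs_fuzzy_number_inverse indicator_def)
qed

lemma level_zero: "a \<in> {0..1} \<Longrightarrow> level 0 a = {0}"
  by (auto simp: level_def membership_zero)

lemma lower_zero: "a \<in> {0..1} \<Longrightarrow> lower 0 a = 0"
  and upper_zero: "a \<in> {0..1} \<Longrightarrow> upper 0 a = 0"
  by (simp_all add: lower_def upper_def level_zero)

lemma THE_level:
  assumes "\<exists>w. \<forall>a\<in>{0..1}. level w a = L a"
  shows "\<forall>a\<in>{0..1}. level (THE w. \<forall>a\<in>{0..1}. level w a = L a) a = L a"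
proof -
  have "\<exists>!w. \<forall>a\<in>{0..1}. level w a = L a"
    using assms by (auto intro!: fuzzy_number_eqI_level)
  then show ?thesis by (rule theI')
qed

lemma level_plus:
  assumes "a \<in> {0..1}"
  shows "level (u + v) a = {lower u a + lower v a..upper u a + upper v a}"
proof -
  have "\<exists>w. \<forall>a\<in>{0..1}. level w a = {lower u a + lower v a..upper u a + upper v a}"
  proof (rule fuzzy_number_from_levels)
    show "lower u 1 + lower v 1 \<le> upper u 1 + upper v 1"
      using level_eq_interval(2)[of 1] by (auto intro: add_mono)
  next
    fix a b :: real assume "0 \<le> a" "a \<le> b" "b \<le> 1"
    then show "lower u a + lower v a \<le> lower u b + lower v b"
      "upper u b + upper v b \<le> upper u a + upper v a"
      by (auto intro: add_mono lower_mono upper_antimono)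
  next
    fix a x :: real assume a: "0 < a" "a \<le> 1" and x: "x < lower u a + lower v a"
    define e where "e = (lower u a + lower v a - x) / 2"
    have e: "0 < e" using x by (simp add: e_def)
    obtain b where b: "0 < b" "b < a" "lower u a - e < lower u b"
      using lower_left_limit[of a "lower u a - e" u] a e by auto
    obtain c where c: "0 < c" "c < a" "lower v a - e < lower v c"
      using lower_left_limit[of a "lower v a - e" v] a e by auto
    have "x < lower u (max b c) + lower v (max b c)"
      using b c a lower_mono[of b "max b c" u] lower_mono[of c "max b c" v]
      by (auto simp: e_def field_simps)
    then show "\<exists>b. 0 < b \<and> b < a \<and> x < lower u b + lower v b"
      using b c by (intro exI[of _ "max b c"]) auto
  next
    fix a x :: real assume a: "0 < a" "a \<le> 1" and x: "upper u a + upper v a < x"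
    define e where "e = (x - (upper u a + upper v a)) / 2"
    have e: "0 < e" using x by (simp add: e_def)
    obtain b where b: "0 < b" "b < a" "upper u b < upper u a + e"
      using upper_left_limit[of a u "upper u a + e"] a e by auto
    obtain c where c: "0 < c" "c < a" "upper v c < upper v a + e"
      using upper_left_limit[of a v "upper v a + e"] a e by auto
    have "upper u (max b c) + upper v (max b c) < x"
      using b c a upper_antimono[of b "max b c" u] upper_antimono[of c "max b c" v]
      by (auto simp: e_def field_simps)
    then show "\<exists>b. 0 < b \<and> b < a \<and> upper u b + upper v b < x"
      using b c by (intro exI[of _ "max b c"]) auto
  next
    fix x assume x: "lower u 0 + lower v 0 < x"
    define e where "e = (x - (lower u 0 + lower v 0)) / 2"
    have e: "0 < e" using x by (simp add: e_def)
    obtain b where b: "0 < b" "b \<le> 1" "lower u b < lower u 0 + e"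
      using lower_right_limit_0[of u "lower u 0 + e"] e by auto
    obtain c where c: "0 < c" "c \<le> 1" "lower v c < lower v 0 + e"
      using lower_right_limit_0[of v "lower v 0 + e"] e by auto
    have "lower u (min b c) + lower v (min b c) < x"
      using b c lower_mono[of "min b c" b u] lower_mono[of "min b c" c v]
      by (auto simp: e_def field_simps)
    then show "\<exists>b. 0 < b \<and> b \<le> 1 \<and> lower u b + lower v b < x"
      using b c by (intro exI[of _ "min b c"]) auto
  next
    fix x assume x: "x < upper u 0 + upper v 0"
    define e where "e = (upper u 0 + upper v 0 - x) / 2"
    have e: "0 < e" using x by (simp add: e_def)
    obtain b where b: "0 < b" "b \<le> 1" "upper u 0 - e < upper u b"
      using upper_right_limit_0[of "upper u 0 - e" u] e by auto
    obtain c where c: "0 < c" "c \<le> 1" "upper v 0 - e < upper v c"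
      using upper_right_limit_0[of "upper v 0 - e" v] e by auto
    have "x < upper u (min b c) + upper v (min b c)"
      using b c upper_antimono[of "min b c" b u] upper_antimono[of "min b c" c v]
      by (auto simp: e_def field_simps)
    then show "\<exists>b. 0 < b \<and> b \<le> 1 \<and> x < upper u b + upper v b"
      using b c by (intro exI[of _ "min b c"]) auto
  qed
  from bspec[OF THE_level[OF this] assms] show ?thesis
    unfolding plus_fuzzy_number_def .
qed

lemma lower_plus: "a \<in> {0..1} \<Longrightarrow> lower (u + v) a = lower u a + lower v a"
  and upper_plus: "a \<in> {0..1} \<Longrightarrow> upper (u + v) a = upper u a + upper v a"
proof -
  assume a: "a \<in> {0..1}"
  have "lower u a + lower v a \<le> upper u a + upper v a"
    using level_eq_interval(2)[OF a] by (intro add_mono)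
  then show "lower (u + v) a = lower u a + lower v a" "upper (u + v) a = upper u a + upper v a"
    using level_plus[OF a, of u v] by (simp_all add: lower_def[of "u + v"] upper_def[of "u + v"])
qed

lemma level_scaleR:
  assumes "a \<in> {0..1}"
  shows "level (k *\<^sub>R u) a = (\<lambda>t. k * t) ` level u a"
proof -
  have "\<exists>w. \<forall>a\<in>{0..1}. level w a = (\<lambda>t. k * t) ` level u a"
  proof -
    consider "k = 0" | "k > 0" | "k < 0" by linarith
    then show ?thesis
    proof cases
      case 1
      then have "\<forall>a\<in>{0..1}. level 0 a = (\<lambda>t. k * t) ` level u a"
        using level_nonempty by (auto simp: level_zero image_constant_conv)
      then show ?thesis by blast
    next
      case k: 2
      have "\<exists>w. \<forall>a\<in>{0..1}. level w a = {k * lower u a..k * upper u a}"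
      proof (rule fuzzy_number_from_levels)
        show "k * lower u 1 \<le> k * upper u 1"
          using level_eq_interval(2)[of 1] k by auto
      next
        fix a b :: real assume "0 \<le> a" "a \<le> b" "b \<le> 1"
        then show "k * lower u a \<le> k * lower u b" "k * upper u b \<le> k * upper u a"
          using k by (auto intro: lower_mono upper_antimono)
      next
        fix a x :: real assume a: "0 < a" "a \<le> 1"
        show "\<exists>b. 0 < b \<and> b < a \<and> x < k * lower u b" if "x < k * lower u a"
        proof -
          have "x / k < lower u a" using that k by (simp add: field_simps)
          then obtain b where "0 < b" "b < a" "x / k < lower u b"
            using lower_left_limit[of a "x / k" u] a by blast
          then show ?thesis using k by (intro exI[of _ b]) (simp add: field_simps)
        qed
        show "\<exists>b. 0 < b \<and> b < a \<and> k * upper u b < x" if "k * upper u a < x"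
        proof -
          have "upper u a < x / k" using that k by (simp add: field_simps)
          then obtain b where "0 < b" "b < a" "upper u b < x / k"
            using upper_left_limit[of a u "x / k"] a by blast
          then show ?thesis using k by (intro exI[of _ b]) (simp add: field_simps)
        qed
      next
        fix x
        show "\<exists>b. 0 < b \<and> b \<le> 1 \<and> k * lower u b < x" if "k * lower u 0 < x"
        proof -
          have "lower u 0 < x / k" using that k by (simp add: field_simps)
          then obtain b where "0 < b" "b \<le> 1" "lower u b < x / k"
            using lower_right_limit_0[of u "x / k"] by blast
          then show ?thesis using k by (intro exI[of _ b]) (simp add: field_simps)
        qed
        show "\<exists>b. 0 < b \<and> b \<le> 1 \<and> x < k * upper u b" if "x < k * upper u 0"
        proof -
          have "x / k < upper u 0" using that k by (simp add: field_simps)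
          then obtain b where "0 < b" "b \<le> 1" "x / k < upper u b"
            using upper_right_limit_0[of "x / k" u] by blast
          then show ?thesis using k by (intro exI[of _ b]) (simp add: field_simps)
        qed
      qed
      moreover have "(\<lambda>t. k * t) ` level u a = {k * lower u a..k * upper u a}"
        if "a \<in> {0..1}" for a
        using level_eq_interval[OF that, of u] k by (simp add: image_mult_atLeastAtMost)
      ultimately show ?thesis by auto
    next
      case k: 3
      have "\<exists>w. \<forall>a\<in>{0..1}. level w a = {k * upper u a..k * lower u a}"
      proof (rule fuzzy_number_from_levels)
        show "k * upper u 1 \<le> k * lower u 1"
          using level_eq_interval(2)[of 1] k by (auto intro: mult_left_mono_neg)
      next
        fix a b :: real assume "0 \<le> a" "a \<le> b" "b \<le> 1"
        then show "k * upper u a \<le> k * upper u b" "k * lower u b \<le> k * lower u a"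
          using k by (auto intro!: mult_left_mono_neg lower_mono upper_antimono)
      next
        fix a x :: real assume a: "0 < a" "a \<le> 1"
        show "\<exists>b. 0 < b \<and> b < a \<and> x < k * upper u b" if "x < k * upper u a"
        proof -
          have "upper u a < x / k" using that k by (simp add: field_simps)
          then obtain b where "0 < b" "b < a" "upper u b < x / k"
            using upper_left_limit[of a u "x / k"] a by blast
          then show ?thesis using k by (intro exI[of _ b]) (simp add: field_simps)
        qed
        show "\<exists>b. 0 < b \<and> b < a \<and> k * lower u b < x" if "k * lower u a < x"
        proof -
          have "x / k < lower u a" using that k by (simp add: field_simps)
          then obtain b where "0 < b" "b < a" "x / k < lower u b"
            using lower_left_limit[of a "x / k" u] a by blast
          then show ?thesis using k by (intro exI[of _ b]) (simp add: field_simps)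
        qed
      next
        fix x
        show "\<exists>b. 0 < b \<and> b \<le> 1 \<and> k * upper u b < x" if "k * upper u 0 < x"
        proof -
          have "x / k < upper u 0" using that k by (simp add: field_simps)
          then obtain b where "0 < b" "b \<le> 1" "x / k < upper u b"
            using upper_right_limit_0[of "x / k" u] by blast
          then show ?thesis using k by (intro exI[of _ b]) (simp add: field_simps)
        qed
        show "\<exists>b. 0 < b \<and> b \<le> 1 \<and> x < k * lower u b" if "x < k * lower u 0"
        proof -
          have "lower u 0 < x / k" using that k by (simp add: field_simps)
          then obtain b where "0 < b" "b \<le> 1" "lower u b < x / k"
            using lower_right_limit_0[of u "x / k"] by blast
          then show ?thesis using k by (intro exI[of _ b]) (simp add: field_simps)
        qed
      qed
      moreover have "(\<lambda>t. k * t) ` level u a = {k * upper u a..k * lower u a}"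
        if "a \<in> {0..1}" for a
        using level_eq_interval[OF that, of u] k by (simp add: image_mult_atLeastAtMost_if)
      ultimately show ?thesis by auto
    qed
  qed
  from bspec[OF THE_level[OF this] assms] show ?thesis
    unfolding scaleR_fuzzy_number_def .
qed

instance fuzzy_number :: comm_monoid_add
proof
  fix u v w :: fuzzy_number
  show "u + v + w = u + (v + w)" "u + v = v + u" "0 + u = u"
    by (rule fuzzy_number_eqI; simp add: lower_plus upper_plus lower_zero upper_zero)+
qed

section \<open>The supremum metric\<close>

instantiation fuzzy_number :: metric_space
begin

definition dist_fuzzy_number :: "fuzzy_number \<Rightarrow> fuzzy_number \<Rightarrow> real" where
  "dist u v = (SUP a\<in>{0..1}. max \<bar>lower u a - lower v a\<bar> \<bar>upper u a - upper v a\<bar>)"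

definition uniformity_fuzzy_number :: "(fuzzy_number \<times> fuzzy_number) filter" where
  "uniformity_fuzzy_number = (INF e\<in>{0<..}. principal {(x, y). dist x y < e})"

definition open_fuzzy_number :: "fuzzy_number set \<Rightarrow> bool" where
  "open_fuzzy_number U \<longleftrightarrow> (\<forall>x\<in>U. eventually (\<lambda>(x', y). x' = x \<longrightarrow> y \<in> U) uniformity)"

lemma bounds_lower_upper:
  assumes "a \<in> {0..1}"
  shows "lower u 0 \<le> lower u a" "lower u a \<le> upper u a" "upper u a \<le> upper u 0"
  using assms lower_mono[of 0 a u] upper_antimono[of 0 a u] level_eq_interval(2)[of a u] by auto

lemma bdd_above_dist_fuzzy_number:
  "bdd_above ((\<lambda>a. max \<bar>lower u a - lower v a\<bar> \<bar>upper u a - upper v a\<bar>) ` {0..1})"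
proof (rule bdd_aboveI2)
  fix a :: real assume a: "a \<in> {0..1}"
  show "max \<bar>lower u a - lower v a\<bar> \<bar>upper u a - upper v a\<bar>
      \<le> \<bar>lower u 0\<bar> + \<bar>upper u 0\<bar> + \<bar>lower v 0\<bar> + \<bar>upper v 0\<bar>"
    using bounds_lower_upper[OF a, of u] bounds_lower_upper[OF a, of v] by linarith
qed

lemma dist_fuzzy_number_upper:
  assumes "a \<in> {0..1}"
  shows "\<bar>lower u a - lower v a\<bar> \<le> dist u v" "\<bar>upper u a - upper v a\<bar> \<le> dist u v"
proof -
  have "max \<bar>lower u a - lower v a\<bar> \<bar>upper u a - upper v a\<bar> \<le> dist u v"
    unfolding dist_fuzzy_number_def
    by (rule cSUP_upper[OF assms bdd_above_dist_fuzzy_number])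
  then show "\<bar>lower u a - lower v a\<bar> \<le> dist u v" "\<bar>upper u a - upper v a\<bar> \<le> dist u v" by auto
qed

lemma dist_fuzzy_number_least:
  assumes "\<And>a. a \<in> {0..1} \<Longrightarrow> \<bar>lower u a - lower v a\<bar> \<le> c"
    and "\<And>a. a \<in> {0..1} \<Longrightarrow> \<bar>upper u a - upper v a\<bar> \<le> c"
  shows "dist u (v :: fuzzy_number) \<le> c"
  unfolding dist_fuzzy_number_def by (rule cSUP_least) (use assms in auto)

instance
proof
  fix u v w :: fuzzy_number
  show "dist u v = 0 \<longleftrightarrow> u = v"
  proof
    assume d: "dist u v = 0"
    show "u = v"
    proof (rule fuzzy_number_eqI)
      fix a :: real assume "a \<in> {0..1}"
      then show "lower u a = lower v a" "upper u a = upper v a"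
        using dist_fuzzy_number_upper[of a u v] d by auto
    qed
  qed (simp add: dist_fuzzy_number_def)
  show "dist u v \<le> dist u w + dist v w"
  proof (rule dist_fuzzy_number_least)
    fix a :: real assume a: "a \<in> {0..1}"
    show "\<bar>lower u a - lower v a\<bar> \<le> dist u w + dist v w"
      "\<bar>upper u a - upper v a\<bar> \<le> dist u w + dist v w"
      using dist_fuzzy_number_upper[OF a, of u w] dist_fuzzy_number_upper[OF a, of v w]
      by linarith+
  qed
qed (simp_all add: uniformity_fuzzy_number_def open_fuzzy_number_def)

end

section \<open>Cesaro summability\<close>

text \<open>Convergence refers to the topology of the metric instance above.\<close>

definition cesaro_summable_seq :: "(nat \<Rightarrow> fuzzy_number) \<Rightarrow> fuzzy_number \<Rightarrow> bool" where
  "cesaro_summable_seq s \<nu> \<longleftrightarrow> (\<lambda>n. (1 / real (n + 1)) *\<^sub>R (\<Sum>k\<le>n. s k)) \<longlonglongrightarrow> \<nu>"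

definition cesaro_summable_series :: "(nat \<Rightarrow> fuzzy_number) \<Rightarrow> fuzzy_number \<Rightarrow> bool" where
  "cesaro_summable_series u \<nu> \<longleftrightarrow> cesaro_summable_seq (\<lambda>n. \<Sum>k\<le>n. u k) \<nu>"

end

theory Submission
  imports Defs
begin

text \<open>
  The endpoints of the level intervals of a sum and of a nonnegative multiple are the sums and
  multiples of the endpoints, so on every level the distance between the partial sum \<open>s\<^sub>n\<close> and
  the Cesaro mean \<open>\<sigma>\<^sub>n\<close> can be computed with real series.  For a real series
  \<open>\<Sum> x\<^sub>k\<close>, counting how often each term occurs in \<open>s\<^sub>0 + \<dots> + s\<^sub>n\<close> gives
  \<open>s\<^sub>n - \<sigma>\<^sub>n = (\<Sum>k\<le>n. k x\<^sub>k) / (n + 1)\<close>.  If \<open>x\<^sub>k\<close> is an endpoint of a level of \<open>u\<^sub>k\<close>, then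
  \<open>\<bar>x\<^sub>k\<bar> \<le> D(u\<^sub>k, 0)\<close>, and this bound does not depend on the level.  The supremum over all
  levels therefore satisfies
  \<open>D(s\<^sub>n, \<sigma>\<^sub>n) \<le> (\<Sum>k\<le>n. k D(u\<^sub>k, 0)) / (n + 1)\<close>, which is the lemma
  \<open>dist_partial_sum_cesaro_mean\<close>.  The right-hand side is the arithmetic mean of a null sequence,
  hence null, so \<open>s\<^sub>n\<close> and \<open>\<sigma>\<^sub>n\<close> have the same limit.
\<close>

lemma arithmetic_mean_null:
  fixes a :: "nat \<Rightarrow> real"
  assumes "a \<longlonglongrightarrow> 0"
  shows "(\<lambda>n. (\<Sum>k\<le>n. a k) / real (n + 1)) \<longlonglongrightarrow> 0"
proof (rule LIMSEQ_I)
  fix e :: real assume e: "0 < e"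
  obtain N where N: "\<bar>a k\<bar> < e / 2" if "k \<ge> N" for k
    using LIMSEQ_D[OF assms, of "e / 2"] e by auto
  define C where "C = (\<Sum>k<N. \<bar>a k\<bar>)"
  obtain M :: nat where M: "2 * C / e < real M"
    using reals_Archimedean2 by blast
  show "\<exists>n0. \<forall>n\<ge>n0. norm ((\<Sum>k\<le>n. a k) / real (n + 1) - 0) < e"
  proof (intro exI allI impI)
    fix n assume n: "n \<ge> M"
    \<comment> \<open>The first \<open>N\<close> terms contribute at most \<open>C\<close> in total, every other term at most \<open>e / 2\<close>.\<close>
    have "\<bar>\<Sum>k\<le>n. a k\<bar> \<le> (\<Sum>k\<le>n. \<bar>a k\<bar>)" by (rule sum_abs)
    also have "\<dots> \<le> (\<Sum>k\<le>n. (if k < N then \<bar>a k\<bar> else 0) + e / 2)"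
      using N e by (intro sum_mono) (auto simp: not_less less_imp_le)
    also have "\<dots> = (\<Sum>k\<in>{..n} \<inter> {..<N}. \<bar>a k\<bar>) + real (n + 1) * (e / 2)"
      by (simp only: sum.distrib sum.inter_restrict[OF finite_atMost] lessThan_iff) simp
    also have "\<dots> \<le> C + real (n + 1) * (e / 2)"
      unfolding C_def by (intro add_right_mono sum_mono2) auto
    also have "\<dots> < real (n + 1) * e"
    proof -
      have "2 * C < real M * e" using M e by (simp add: field_simps)
      also have "\<dots> \<le> real (n + 1) * e" using n e by (intro mult_right_mono) auto
      finally show ?thesis by simp
    qed
    finally show "norm ((\<Sum>k\<le>n. a k) / real (n + 1) - 0) < e"
      by (simp add: field_simps)
  qed
qed

text \<open>The term \<open>x k\<close> occurs in \<open>n + 1 - k\<close> of the partial sums with index at most \<open>n\<close>.\<close>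

lemma sum_partial_sums:
  fixes x :: "nat \<Rightarrow> real"
  shows "(\<Sum>m\<le>n. \<Sum>k\<le>m. x k) = real (n + 1) * (\<Sum>k\<le>n. x k) - (\<Sum>k\<le>n. real k * x k)"
  by (induction n) (simp_all add: algebra_simps)

lemma partial_sum_minus_mean_bound:
  fixes x d :: "nat \<Rightarrow> real"
  assumes "\<And>k. \<bar>x k\<bar> \<le> d k"
  shows "\<bar>(\<Sum>k\<le>n. x k) - 1 / real (n + 1) * (\<Sum>m\<le>n. \<Sum>k\<le>m. x k)\<bar>
    \<le> (\<Sum>k\<le>n. real k * d k) / real (n + 1)"
proof -
  have "(\<Sum>k\<le>n. x k) - 1 / real (n + 1) * (\<Sum>m\<le>n. \<Sum>k\<le>m. x k)
      = (\<Sum>k\<le>n. real k * x k) / real (n + 1)"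
    unfolding sum_partial_sums by (simp add: field_simps)
  moreover have "\<bar>\<Sum>k\<le>n. real k * x k\<bar> \<le> (\<Sum>k\<le>n. real k * d k)"
    using assms by (intro order_trans[OF sum_abs] sum_mono) (simp add: abs_mult mult_left_mono)
  ultimately show ?thesis by (simp add: divide_right_mono)
qed

lemma lower_sum: "a \<in> {0..1} \<Longrightarrow> lower (sum f A) a = (\<Sum>i\<in>A. lower (f i) a)"
  and upper_sum: "a \<in> {0..1} \<Longrightarrow> upper (sum f A) a = (\<Sum>i\<in>A. upper (f i) a)"
  by (induction A rule: infinite_finite_induct)
    (simp_all add: lower_zero upper_zero lower_plus upper_plus)

text \<open>Multiplication by a negative number would exchange the two endpoints.\<close>

lemma
  assumes "a \<in> {0..1}" "0 \<le> c"
  shows lower_scaleR: "lower (c *\<^sub>R u) a = c * lower u a"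
    and upper_scaleR: "upper (c *\<^sub>R u) a = c * upper u a"
proof -
  have le: "lower u a \<le> upper u a" by (rule level_eq_interval(2)[OF assms(1)])
  have "level (c *\<^sub>R u) a = {c * lower u a..c * upper u a}"
    using level_scaleR[OF assms(1), of c u] level_eq_interval(1)[OF assms(1), of u] assms(2) le
    by (simp add: image_mult_atLeastAtMost_if)
  then show "lower (c *\<^sub>R u) a = c * lower u a" "upper (c *\<^sub>R u) a = c * upper u a"
    using level_eq_iff[OF assms(1) mult_left_mono[OF le assms(2)]] by blast+
qed

text \<open>
  Fuzzy numbers have no additive inverses, so the difference of a partial sum and a Cesaro mean is
  formed on the endpoints of each level.
\<close>

lemma dist_partial_sum_cesaro_mean:
  fixes u :: "nat \<Rightarrow> fuzzy_number"
  shows "dist (\<Sum>k\<le>n. u k) ((1 / real (n + 1)) *\<^sub>R (\<Sum>m\<le>n. \<Sum>k\<le>m. u k))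
    \<le> (\<Sum>k\<le>n. real k * dist (u k) 0) / real (n + 1)"
proof (rule dist_fuzzy_number_least)
  fix a :: real assume a: "a \<in> {0..1}"
  have "\<bar>lower (u k) a\<bar> \<le> dist (u k) 0" "\<bar>upper (u k) a\<bar> \<le> dist (u k) 0" for k
    using dist_fuzzy_number_upper[OF a, of "u k" 0] a by (simp_all add: lower_zero upper_zero)
  note bound = this[THEN partial_sum_minus_mean_bound]
  have nonneg: "0 \<le> 1 / real (n + 1)" by simp
  show "\<bar>lower (\<Sum>k\<le>n. u k) a - lower ((1 / real (n + 1)) *\<^sub>R (\<Sum>m\<le>n. \<Sum>k\<le>m. u k)) a\<bar>
      \<le> (\<Sum>k\<le>n. real k * dist (u k) 0) / real (n + 1)"
    unfolding lower_scaleR[OF a nonneg] lower_sum[OF a] by (rule bound(1))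
  show "\<bar>upper (\<Sum>k\<le>n. u k) a - upper ((1 / real (n + 1)) *\<^sub>R (\<Sum>m\<le>n. \<Sum>k\<le>m. u k)) a\<bar>
      \<le> (\<Sum>k\<le>n. real k * dist (u k) 0) / real (n + 1)"
    unfolding upper_scaleR[OF a nonneg] upper_sum[OF a] by (rule bound(2))
qed

theorem corollary5p2:
  fixes u :: "nat \<Rightarrow> fuzzy_number" and \<nu> :: fuzzy_number
  assumes "cesaro_summable_series u \<nu>"
    and "(\<lambda>n. real n * dist (u n) 0) \<in> o(\<lambda>n. 1)"
  shows "u sums \<nu>"
proof -
  define s where "s n = (\<Sum>k\<le>n. u k)" for n
  define \<sigma> where "\<sigma> n = (1 / real (n + 1)) *\<^sub>R (\<Sum>m\<le>n. s m)" for n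
  have mean: "(\<lambda>n. dist (\<sigma> n) \<nu>) \<longlonglongrightarrow> 0"
    using assms(1)
    unfolding cesaro_summable_series_def cesaro_summable_seq_def s_def \<sigma>_def
    by (rule tendsto_dist_iff[THEN iffD1])
  have "(\<lambda>n. real n * dist (u n) 0) \<longlonglongrightarrow> 0"
    using smalloD_tendsto[OF assms(2)] by simp
  then have "(\<lambda>n. (\<Sum>k\<le>n. real k * dist (u k) 0) / real (n + 1)) \<longlonglongrightarrow> 0"
    by (rule arithmetic_mean_null)
  then have bound: "(\<lambda>n. (\<Sum>k\<le>n. real k * dist (u k) 0) / real (n + 1) + dist (\<sigma> n) \<nu>) \<longlonglongrightarrow> 0"
    using mean by (rule tendsto_add_zero)
  have le: "dist (s n) \<nu> \<le> (\<Sum>k\<le>n. real k * dist (u k) 0) / real (n + 1) + dist (\<sigma> n) \<nu>" for n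
    using dist_triangle[of "s n" \<nu> "\<sigma> n"] dist_partial_sum_cesaro_mean[of u n]
    unfolding s_def \<sigma>_def by linarith
  have "(\<lambda>n. dist (s n) \<nu>) \<longlonglongrightarrow> 0"
    using le by (intro tendsto_sandwich[OF _ _ tendsto_const bound]) auto
  then have "s \<longlonglongrightarrow> \<nu>" by (rule tendsto_dist_iff[THEN iffD2])
  then show ?thesis by (simp add: sums_def_le s_def[abs_def])
qed

end
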